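(* Let $H$ be a hypergraph with weight functions $w_V:V(H)\to(0,\infty)$ and $w_E:E(H)\to(0,\infty)$ and associated adjacency matrix $A_H$. For any linearly dependent set of vertices $U\subseteq V(H)$, if there is a constant $c_U\in\mathbb{R}$ such that $w_V(u)\sum_{e\in E_u(H)}w_E(e)=c_U$ for all $u\in U$, then $-c_U$ is an eigenvalue of $A_H$.
   Context: A hypergraph $H=(V(H),E(H))$ consists of a finite non-empty vertex set $V(H)$ and a set $E(H)\subseteq\mathcal{P}(V(H))$ of hyperedges. The star of $v$ is $E_v(H)=\{e\in E(H):v\in e\}$. Let $i_{ve}=1$ if $v\in e$ and $0$ otherwise, and $s_v:E(H)\to\{0,1\}$, $s_v(e)=i_{ve}$. A set $U\subseteq V(H)$ is linearly dependent if the family $(s_v)_{v\in U}$ (indexed by $U$) is linearly dependent. The adjacency matrix $A_H=[a_{uv}]_{u,v\in V(H)}$ of the weighted hypergraph is defined by $a_{uu}=0$ for all $u\in V(H)$ and, for distinct $u,v\in V(H)$, $a_{uv}=\sum_{e\in E(H)}w_V(u)\,i_{ue}\,i_{ve}\,w_E(e)$. *)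

theory Defs
  imports "Jordan_Normal_Form.Char_Poly"
begin

locale hypergraph =
  fixes V :: "'a set" and E :: "'a set set"
  assumes finite_vertices: "finite V"
    and nonempty_vertices: "V \<noteq> {}"
    and edges_subset: "E \<subseteq> Pow V"

locale weighted_hypergraph = hypergraph V E
  for V :: "'a set" and E :: "'a set set" +
  fixes wV :: "'a \<Rightarrow> real" and wE :: "'a set \<Rightarrow> real"
  assumes vertex_weight_pos: "\<And>v. v \<in> V \<Longrightarrow> wV v > 0"
    and edge_weight_pos: "\<And>e. e \<in> E \<Longrightarrow> wE e > 0"

definition star :: "'a set set \<Rightarrow> 'a \<Rightarrow> 'a set set" where
  "star E v = {e \<in> E. v \<in> e}"

definition incidence :: "'a \<Rightarrow> 'a set \<Rightarrow> real" where
  "incidence v e = (if v \<in> e then 1 else 0)"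

text \<open>
  Linear dependence over the reals of the family \<open>(f i)\<close>, indexed by \<open>i \<in> I\<close>, of functions
  on \<open>B\<close>; values outside \<open>B\<close> are ignored. The notion concerns the family and not the set
  of its members: a family that takes the same value at two different indices is dependent.
\<close>

definition dependent_family :: "'b set \<Rightarrow> 'i set \<Rightarrow> ('i \<Rightarrow> 'b \<Rightarrow> real) \<Rightarrow> bool" where
  "dependent_family B I f \<longleftrightarrow>
    (\<exists>J c. finite J \<and> J \<subseteq> I \<and> (\<exists>i\<in>J. c i \<noteq> 0) \<and> (\<forall>b\<in>B. (\<Sum>i\<in>J. c i * f i b) = 0))"

text \<open>The function \<open>s\<^sub>v\<close> attached to a vertex \<open>v\<close> is \<open>incidence v\<close>, regarded on \<open>E\<close>.\<close>

definition dependent_vertices :: "'a set set \<Rightarrow> 'a set \<Rightarrow> bool" where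
  "dependent_vertices E U \<longleftrightarrow> dependent_family E U incidence"

definition adjacency :: "'a set set \<Rightarrow> ('a \<Rightarrow> real) \<Rightarrow> ('a set \<Rightarrow> real) \<Rightarrow> 'a \<Rightarrow> 'a \<Rightarrow> real" where
  "adjacency E wV wE u v =
    (if u = v then 0 else (\<Sum>e\<in>E. wV u * incidence u e * incidence v e * wE e))"

text \<open>
  Matrices are indexed by natural numbers, so the list \<open>vs\<close>, meant to enumerate the vertex set
  without repetition, provides the numbering of the rows and columns.
\<close>

definition adjacency_matrix ::
  "'a list \<Rightarrow> 'a set set \<Rightarrow> ('a \<Rightarrow> real) \<Rightarrow> ('a set \<Rightarrow> real) \<Rightarrow> real mat" where
  "adjacency_matrix vs E wV wE =
    mat (length vs) (length vs) (\<lambda>(i, j). adjacency E wV wE (vs ! i) (vs ! j))"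

end

theory Submission
  imports Defs
begin

text \<open>
  Let \<open>D\<close> be the diagonal matrix with entries \<open>wV u * (\<Sum>e\<in>star E u. wE e)\<close>. Deleting the
  diagonal of the Gram-like matrix \<open>B\<close> with entries
  \<open>\<Sum>e\<in>E. wV u * incidence u e * incidence v e * wE e\<close> amounts to subtracting \<open>D\<close>, because an
  incidence is its own square; so the adjacency matrix is \<open>B - D\<close>. The entry of \<open>B x\<close> at \<open>u\<close> is a
  combination, over the edges \<open>e\<close>, of the edge sums \<open>\<Sum>v\<in>V. x v * incidence v e\<close>. A vector all of
  whose edge sums vanish is therefore killed by \<open>B\<close>, and the adjacency matrix acts on it as \<open>- D\<close>
  (lemma \<open>adjacency_sum_of_vanishing_edge_sums\<close>).

  A dependence among the incidence vectors of the vertices in \<open>U\<close>, extended by zero to all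
  vertices, is exactly a nonzero vector of this kind with support in \<open>U\<close>. When the diagonal entries
  of \<open>D\<close> agree with a constant \<open>c\<close> on \<open>U\<close>, that vector is an eigenvector for \<open>- c\<close>.
\<close>

lemma dependent_vertices_obtain_vector:
  assumes "finite V" and "U \<subseteq> V" and "dependent_vertices E U"
  obtains x where "\<And>v. v \<notin> U \<Longrightarrow> x v = 0" and "\<exists>v\<in>V. x v \<noteq> 0"
    and "\<And>e. e \<in> E \<Longrightarrow> (\<Sum>v\<in>V. x v * incidence v e) = 0"
proof -
  from assms(3) obtain J a where J: "J \<subseteq> U" "\<exists>v\<in>J. a v \<noteq> 0"
    and zero: "\<And>e. e \<in> E \<Longrightarrow> (\<Sum>v\<in>J. a v * incidence v e) = 0"
    unfolding dependent_vertices_def dependent_family_def by blast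
  define x where "x = (\<lambda>v. if v \<in> J then a v else 0)"
  show thesis
  proof
    show "x v = 0" if "v \<notin> U" for v
      using that J(1) by (auto simp: x_def)
    show "\<exists>v\<in>V. x v \<noteq> 0"
      using J assms(2) by (auto simp: x_def)
    show "(\<Sum>v\<in>V. x v * incidence v e) = 0" if "e \<in> E" for e
    proof -
      have "(\<Sum>v\<in>J. a v * incidence v e) = (\<Sum>v\<in>V. x v * incidence v e)"
        using assms(1,2) J(1) by (intro sum.mono_neutral_cong_left) (auto simp: x_def)
      with zero[OF that] show ?thesis by simp
    qed
  qed
qed

lemma sum_incidence_eq_sum_star:
  assumes "finite E"
  shows "(\<Sum>e\<in>E. incidence u e * f e) = (\<Sum>e\<in>star E u. f e)"
  unfolding star_def using assms
  by (intro sum.mono_neutral_cong_right) (auto simp: incidence_def)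

text \<open>
  Adding the diagonal back turns the row of the adjacency matrix into one whose product with \<open>x\<close>
  is a combination of edge sums, hence zero; what remains is the diagonal correction.
\<close>

lemma adjacency_sum_of_vanishing_edge_sums:
  assumes "finite V" and "finite E" and "u \<in> V"
    and edge_sums: "\<And>e. e \<in> E \<Longrightarrow> (\<Sum>v\<in>V. x v * incidence v e) = 0"
  shows "(\<Sum>v\<in>V. adjacency E wV wE u v * x v) = - (wV u * (\<Sum>e\<in>star E u. wE e)) * x u"
proof -
  define b where "b v = (\<Sum>e\<in>E. wV u * incidence u e * incidence v e * wE e)" for v
  have "(\<Sum>v\<in>V. b v * x v)
      = (\<Sum>e\<in>E. wV u * incidence u e * wE e * (\<Sum>v\<in>V. x v * incidence v e))"
    unfolding b_def sum_distrib_left sum_distrib_right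
    by (subst sum.swap) (simp add: mult_ac)
  also have "\<dots> = 0"
    by (simp add: edge_sums)
  finally have b_zero: "(\<Sum>v\<in>V. b v * x v) = 0" .
  have "b u = wV u * (\<Sum>e\<in>E. incidence u e * wE e)"
    unfolding b_def sum_distrib_left by (intro sum.cong) (auto simp: incidence_def)
  then have b_diag: "b u = wV u * (\<Sum>e\<in>star E u. wE e)"
    by (simp add: sum_incidence_eq_sum_star[OF assms(2)])
  have "(\<Sum>v\<in>V. adjacency E wV wE u v * x v) = (\<Sum>v\<in>V - {u}. b v * x v)"
    using assms(1) by (intro sum.mono_neutral_cong_right) (auto simp: adjacency_def b_def)
  also have "\<dots> = (\<Sum>v\<in>V. b v * x v) - b u * x u"
    using assms(1,3) by (simp add: sum_diff1)
  finally show ?thesis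
    by (simp add: b_zero b_diag)
qed

text \<open>
  The numbering of the vertices is irrelevant to the spectrum: an eigenvector of the matrix may be
  given as a function on vertices.
\<close>

lemma eigenvalue_adjacency_matrixI:
  assumes "distinct vs" and "\<exists>v\<in>set vs. x v \<noteq> 0"
    and eq: "\<And>u. u \<in> set vs \<Longrightarrow> (\<Sum>v\<in>set vs. adjacency E wV wE u v * x v) = k * x u"
  shows "eigenvalue (adjacency_matrix vs E wV wE) k"
proof -
  let ?A = "adjacency_matrix vs E wV wE"
  define y where "y = vec (length vs) (\<lambda>i. x (vs ! i))"
  have "?A *\<^sub>v y = k \<cdot>\<^sub>v y"
  proof (rule eq_vecI)
    fix i assume "i < dim_vec (k \<cdot>\<^sub>v y)"
    then have i: "i < length vs" by (simp add: y_def)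
    have "(?A *\<^sub>v y) $ i
        = (\<Sum>j<length vs. adjacency E wV wE (vs ! i) (vs ! j) * x (vs ! j))"
      using i by (simp add: adjacency_matrix_def y_def scalar_prod_def atLeast0LessThan)
    also have "\<dots> = (\<Sum>v\<in>set vs. adjacency E wV wE (vs ! i) v * x v)"
      by (rule sum.reindex_bij_betw[OF bij_betw_nth[OF assms(1) refl refl]])
    also have "\<dots> = (k \<cdot>\<^sub>v y) $ i"
      using i by (simp add: eq y_def)
    finally show "(?A *\<^sub>v y) $ i = (k \<cdot>\<^sub>v y) $ i" .
  qed (simp add: adjacency_matrix_def y_def)
  moreover have "y \<noteq> 0\<^sub>v (length vs)"
  proof -
    obtain i where "i < length vs" "x (vs ! i) \<noteq> 0"
      using assms(2) by (auto simp: in_set_conv_nth)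
    then have "y $ i \<noteq> 0\<^sub>v (length vs) $ i" by (simp add: y_def)
    then show ?thesis by metis
  qed
  ultimately have "eigenvector ?A y k"
    by (simp add: eigenvector_def adjacency_matrix_def y_def)
  then show ?thesis
    unfolding eigenvalue_def by blast
qed

theorem corollary3p4:
  fixes V :: "'a set" and E :: "'a set set"
    and wV :: "'a \<Rightarrow> real" and wE :: "'a set \<Rightarrow> real"
    and vs :: "'a list" and U :: "'a set" and c :: real
  assumes "weighted_hypergraph V E wV wE"
    and "distinct vs" and "set vs = V"
    and "U \<subseteq> V" and "dependent_vertices E U"
    and "\<And>u. u \<in> U \<Longrightarrow> wV u * (\<Sum>e\<in>star E u. wE e) = c"
  shows "eigenvalue (adjacency_matrix vs E wV wE) (- c)"
proof -
  interpret weighted_hypergraph V E wV wE by (fact assms(1))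
  have "finite E"
    using finite_vertices edges_subset by (meson finite_Pow_iff finite_subset)
  obtain x where x_outside: "\<And>v. v \<notin> U \<Longrightarrow> x v = 0" and x_nonzero: "\<exists>v\<in>V. x v \<noteq> 0"
    and edge_sums: "\<And>e. e \<in> E \<Longrightarrow> (\<Sum>v\<in>V. x v * incidence v e) = 0"
    using dependent_vertices_obtain_vector[OF finite_vertices assms(4,5)] by blast
  have "(\<Sum>v\<in>V. adjacency E wV wE u v * x v) = - c * x u" if "u \<in> V" for u
  proof -
    have "(\<Sum>v\<in>V. adjacency E wV wE u v * x v) = - (wV u * (\<Sum>e\<in>star E u. wE e)) * x u"
      by (rule adjacency_sum_of_vanishing_edge_sums)
        (use finite_vertices \<open>finite E\<close> that edge_sums in auto)
    \<comment> \<open>Off \<open>U\<close> the diagonal entry is arbitrary, but there \<open>x\<close> vanishes.\<close>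
    also have "\<dots> = - c * x u"
      by (cases "u \<in> U") (simp_all add: assms(6) x_outside)
    finally show ?thesis .
  qed
  with assms(2,3) x_nonzero show ?thesis
    by (intro eigenvalue_adjacency_matrixI) auto
qed

end
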